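(* Let $m\ge 1$ and let $s_{\min},s_{\max}$ be integers with $0\le s_{\min}\le s_{\max}\le m-1$. For the complete--$S$ pliable index coding (PICOD) problem with $m$ messages and $S=[s_{\min}:s_{\max}]=\{s_{\min},s_{\min}+1,\dots,s_{\max}\}$, the optimal (normalized) code length is $$\ell^*=\min\{m-s_{\min},\; s_{\max}+1\},$$ and this optimal length is achieved by linear codes.
   Context: PICOD problem: a single server holds $m$ independent messages $w_1,\dots,w_m$, each uniformly distributed over binary strings of $k$ bits; write $W=\{w_1,\dots,w_m\}$ and, for $A\subseteq[m]$, $W_A=\{w_a: a\in A\}$. There are $n$ users $u_1,\dots,u_n$; user $u_j$ has side information $W_{A_j}$ for a known set $A_j\subset[m]$. The server broadcasts over a noiseless channel a codeword $x^{\ell k}=\mathsf{ENC}(W)$ of $\ell k$ bits (the encoder may depend on the globally known collection $\{A_1,\dots,A_n\}$). User $u_j$ applies a decoder $\widehat w_j=\mathsf{DEC}_j(W_{A_j},x^{\ell k})$. A code is valid if for every user $u_j$ there exists an index $d_j\in[m]\setminus A_j$ (the desired message, which may be chosen freely as part of the code design) such that $\Pr[\widehat w_j\neq w_{d_j}]\le\epsilon$. The optimal code length $\ell^*$ is the smallest $\ell$ such that a valid code of length $\ell k$ bits exists for some message length $k$. The complete--$S$ PICOD with $m$ messages, for $S\subseteq[0:m-1]$, is the PICOD instance with $n=\sum_{s\in S}\binom{m}{s}$ users whose side information sets are exactly all the distinct subsets of $[m]$ whose cardinality lies in $S$ (each such subset is the side information set of exactly one user). A linear code is one in which the transmitted bits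 are linear functions (over a finite field) of the message bits. *)

theory Defs
  imports Complex_Main
begin

text \<open>
  Messages: a message tuple W is a function nat => nat => bool, where W i j is bit j
  of message w_(i+1) (messages indexed 0..m-1, bits 0..k-1). Only the tuples that are
  False outside that range are considered; the uniform distribution over messages is
  the uniform distribution over this finite set (cardinality 2^(m*k)).
  Codewords: nat => bool, of which only the first L bits are transmitted.
\<close>

definition msgs :: "nat \<Rightarrow> nat \<Rightarrow> (nat \<Rightarrow> nat \<Rightarrow> bool) set" where
  "msgs m k = {W. \<forall>i j. (m \<le> i \<or> k \<le> j) \<longrightarrow> \<not> W i j}"

definition trunc :: "nat \<Rightarrow> (nat \<Rightarrow> bool) \<Rightarrow> (nat \<Rightarrow> bool)" where
  "trunc L x = (\<lambda>t. t < L \<and> x t)"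

definition side_info :: "nat set \<Rightarrow> (nat \<Rightarrow> nat \<Rightarrow> bool) \<Rightarrow> (nat \<Rightarrow> nat \<Rightarrow> bool)" where
  "side_info A W = (\<lambda>i j. i \<in> A \<and> W i j)"

definition users :: "nat \<Rightarrow> nat set \<Rightarrow> nat set set" where
  "users m S = {A. A \<subseteq> {..<m} \<and> card A \<in> S}"

definition err_prob ::
  "nat \<Rightarrow> nat \<Rightarrow> nat \<Rightarrow> ((nat \<Rightarrow> nat \<Rightarrow> bool) \<Rightarrow> nat \<Rightarrow> bool)
   \<Rightarrow> ((nat \<Rightarrow> nat \<Rightarrow> bool) \<Rightarrow> (nat \<Rightarrow> bool) \<Rightarrow> (nat \<Rightarrow> bool))
   \<Rightarrow> nat set \<Rightarrow> nat \<Rightarrow> real" where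
  "err_prob m k L enc decA A d =
     real (card {W \<in> msgs m k. decA (side_info A W) (trunc L (enc W)) \<noteq> W d})
     / real (card (msgs m k))"

definition valid_code ::
  "nat \<Rightarrow> nat set \<Rightarrow> nat \<Rightarrow> nat \<Rightarrow> real
   \<Rightarrow> ((nat \<Rightarrow> nat \<Rightarrow> bool) \<Rightarrow> nat \<Rightarrow> bool)
   \<Rightarrow> (nat set \<Rightarrow> (nat \<Rightarrow> nat \<Rightarrow> bool) \<Rightarrow> (nat \<Rightarrow> bool) \<Rightarrow> (nat \<Rightarrow> bool))
   \<Rightarrow> (nat set \<Rightarrow> nat) \<Rightarrow> bool" where
  "valid_code m S k L eps enc dec d \<longleftrightarrow>
     (\<forall>A \<in> users m S. d A < m \<and> d A \<notin> A \<and> err_prob m k L enc (dec A) A (d A) \<le> eps)"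

definition achievable :: "nat \<Rightarrow> nat set \<Rightarrow> real \<Rightarrow> bool" where
  "achievable m S l \<longleftrightarrow>
     (\<forall>eps > 0. \<exists>k L enc dec d. 0 < k \<and> real L \<le> l * real k \<and> valid_code m S k L eps enc dec d)"

definition opt_len :: "nat \<Rightarrow> nat set \<Rightarrow> real" where
  "opt_len m S = Inf {l. achievable m S l}"

text \<open>Linear (over GF(2)) encoder: every transmitted bit is an XOR of message bits,
  i.e. the transmitted part of the encoder is additive w.r.t. bitwise XOR.\<close>
definition linear_enc :: "nat \<Rightarrow> nat \<Rightarrow> nat \<Rightarrow> ((nat \<Rightarrow> nat \<Rightarrow> bool) \<Rightarrow> nat \<Rightarrow> bool) \<Rightarrow> bool" where
  "linear_enc m k L enc \<longleftrightarrow>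
     (\<forall>W1 \<in> msgs m k. \<forall>W2 \<in> msgs m k.
        trunc L (enc (\<lambda>i j. W1 i j \<noteq> W2 i j)) = (\<lambda>t. trunc L (enc W1) t \<noteq> trunc L (enc W2) t))"

end

theory Submission
  imports Defs "HOL-Library.Z2" "HOL-Computational_Algebra.Polynomial"
begin

text \<open>
  Converse. If two message tuples are decoded correctly by all users and produce the same
  codeword, then the set of messages on which they agree is closed: it contains the desired
  message of every user whose side information it contains. Closed sets are stable under
  intersection, and none has a cardinality in \<open>[smin:smax]\<close>. Combinatorially this forces
  a set \<open>A\<close> of at most \<open>m - min (m - smin) (smax + 1)\<close> messages that is
  contained in no proper closed set, so the codeword together with the messages in \<open>A\<close>
  determines everything, and counting bounds the code length.

  To find \<open>A\<close>, take a minimal generating set. If it were too large, the closures of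
  \<open>A - {x}\<close>, suitably truncated outside \<open>A\<close>, would be nonempty subsets of a set with
  fewer than \<open>card A\<close> elements. Then some \<open>j\<close> of them have exactly
  \<open>j - 1\<close> points in common, and the intersection of the corresponding closed sets has a
  forbidden cardinality.

  Achievability. Either \<open>smax + 1\<close> messages are sent uncoded, or one sends \<open>m - smin\<close>
  Vandermonde combinations of all messages, read as polynomials over \<open>GF(2)\<close> modulo a
  fixed polynomial.
\<close>

section \<open>Double counting in set families with more members than points\<close>

text \<open>Give each incidence \<open>b \<in> \<gamma> i\<close> the weight
  \<open>1 / card (\<gamma> i)\<close>; the total is \<open>card I\<close>. If no degree exceeded
  the size of a member at that point, weighting by \<open>1 / deg b\<close> instead could only
  increase the total, yet each point then contributes at most 1, so
  \<open>card I \<le> card B\<close>.\<close>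

lemma exists_edge_degree_gt:
  fixes \<gamma> :: "'a \<Rightarrow> 'b set"
  assumes "finite I" "finite B" "card B < card I"
    and \<gamma>: "\<And>i. i \<in> I \<Longrightarrow> \<gamma> i \<noteq> {} \<and> \<gamma> i \<subseteq> B"
  shows "\<exists>i\<in>I. \<exists>b\<in>\<gamma> i. card (\<gamma> i) < card {j \<in> I. b \<in> \<gamma> j}"
proof (rule ccontr)
  define deg where "deg b = card {j \<in> I. b \<in> \<gamma> j}" for b
  assume "\<not> ?thesis"
  then have le: "deg b \<le> card (\<gamma> i)" if "i \<in> I" "b \<in> \<gamma> i" for i b
    using that by (auto simp: deg_def not_less)
  have fin: "finite (\<gamma> i)" if "i \<in> I" for i
    using \<gamma> that \<open>finite B\<close> finite_subset by blast
  have pos: "0 < deg b" if "i \<in> I" "b \<in> \<gamma> i" for i b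
    using that \<open>finite I\<close> by (auto simp: deg_def card_gt_0_iff)
  have pos': "0 < card (\<gamma> i)" if "i \<in> I" for i
    using that \<gamma> fin by (auto simp: card_gt_0_iff)
  have "real (card I) = (\<Sum>i\<in>I. \<Sum>b\<in>\<gamma> i. 1 / real (card (\<gamma> i)))"
    using \<gamma> fin by simp
  also have "\<dots> \<le> (\<Sum>i\<in>I. \<Sum>b\<in>\<gamma> i. 1 / real (deg b))"
    using le pos pos' by (intro sum_mono divide_left_mono) auto
  also have "\<dots> = (\<Sum>i\<in>I. \<Sum>b\<in>{b \<in> B. b \<in> \<gamma> i}. 1 / real (deg b))"
    using \<gamma> by (intro sum.cong) auto
  also have "\<dots> = (\<Sum>b\<in>B. \<Sum>i\<in>{i \<in> I. b \<in> \<gamma> i}. 1 / real (deg b))"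
    by (rule sum.swap_restrict) fact+
  also have "\<dots> = (\<Sum>b\<in>B. real (deg b) / real (deg b))"
    by (simp add: deg_def)
  also have "\<dots> \<le> (\<Sum>b\<in>B. 1)"
    by (intro sum_mono) auto
  finally show False
    using \<open>card B < card I\<close> by simp
qed

text \<open>Fix a member \<open>\<gamma> i\<close> and a point \<open>b\<close> in it of larger
  degree. The other members through \<open>b\<close>, cut down to \<open>\<gamma> i - {b}\<close>,
  still outnumber the available points. If one of the cuts is empty, that member and
  \<open>\<gamma> i\<close> meet in \<open>b\<close> alone; otherwise induction applies, and putting
  \<open>i\<close> back adds one index while putting \<open>b\<close> back adds one common
  point.\<close>

lemma exists_family_card_eq_Suc_card_Inter:
  fixes \<gamma> :: "'a \<Rightarrow> 'b set"
  assumes "finite I" "finite B" "card B < card I"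
    and "\<And>i. i \<in> I \<Longrightarrow> \<gamma> i \<noteq> {} \<and> \<gamma> i \<subseteq> B"
  shows "\<exists>J\<subseteq>I. J \<noteq> {} \<and> card J = Suc (card (\<Inter>i\<in>J. \<gamma> i))"
  using assms
proof (induction "card B" arbitrary: I B \<gamma> rule: less_induct)
  case less
  obtain i b where ib: "i \<in> I" "b \<in> \<gamma> i" "card (\<gamma> i) < card {j \<in> I. b \<in> \<gamma> j}"
    using exists_edge_degree_gt[of I B \<gamma>] less.prems by blast
  define I' where "I' = {j \<in> I. b \<in> \<gamma> j} - {i}"
  define B' where "B' = \<gamma> i - {b}"
  have fin\<gamma>: "finite (\<gamma> i)"
    using less.prems(2,4) ib(1) by (meson finite_subset)
  then have fin: "finite I'" "finite (\<gamma> i)" "finite B'"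
    using less.prems(1) by (simp_all add: I'_def B'_def)
  have cB': "card (\<gamma> i) = Suc (card B')"
    using ib fin by (metis B'_def card.remove)
  have "card {j \<in> I. b \<in> \<gamma> j} = Suc (card I')"
    using ib less.prems(1) unfolding I'_def by (intro card.remove) auto
  then have c: "card B' < card I'"
    using ib(3) cB' by simp
  show ?case
  proof (cases "\<exists>j\<in>I'. \<gamma> j \<inter> B' = {}")
    case True
    then obtain j where j: "j \<in> I'" "\<gamma> j \<inter> B' = {}"
      by blast
    then have "(\<Inter>k\<in>{i, j}. \<gamma> k) = {b}"
      using ib by (auto simp: I'_def B'_def)
    moreover have "card {i, j} = 2"
      using j by (auto simp: I'_def)
    ultimately show ?thesis
      using j ib by (intro exI[of _ "{i, j}"]) (auto simp: I'_def)
  next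
    case False
    have "card B' < card B"
      using cB' less.prems ib by (metis Suc_le_lessD card_mono)
    then obtain J where J: "J \<subseteq> I'" "J \<noteq> {}" "card J = Suc (card (\<Inter>k\<in>J. \<gamma> k \<inter> B'))"
      using less.hyps[of B' I' "\<lambda>k. \<gamma> k \<inter> B'"] fin c False by blast
    have eq: "(\<Inter>k\<in>insert i J. \<gamma> k) = insert b (\<Inter>k\<in>J. \<gamma> k \<inter> B')"
      using J ib by (auto simp: I'_def B'_def)
    have sub: "(\<Inter>k\<in>J. \<gamma> k \<inter> B') \<subseteq> B'"
      using J by blast
    then have "finite (\<Inter>k\<in>J. \<gamma> k \<inter> B')" "b \<notin> (\<Inter>k\<in>J. \<gamma> k \<inter> B')"
      using fin(3) finite_subset by (blast, auto simp: B'_def)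
    moreover have "finite J" "i \<notin> J"
      using J fin(1) finite_subset by (auto simp: I'_def)
    ultimately have "card (insert i J) = Suc (card (\<Inter>k\<in>insert i J. \<gamma> k))"
      using J(3) unfolding eq by simp
    then show ?thesis
      using J ib by (intro exI[of _ "insert i J"]) (auto simp: I'_def)
  qed
qed

section \<open>Generators of closure systems with a gap in the cardinalities\<close>

lemma closure_system_small_generator:
  fixes F :: "'a set set"
  assumes "finite X" "X \<in> F" and sub: "\<And>C. C \<in> F \<Longrightarrow> C \<subseteq> X"
    and inter: "\<And>G. G \<subseteq> F \<Longrightarrow> G \<noteq> {} \<Longrightarrow> \<Inter>G \<in> F"
    and gap: "\<And>C. C \<in> F \<Longrightarrow> card C \<notin> {lo..hi}"
    and "lo \<le> hi" "hi < card X"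
  shows "\<exists>A\<subseteq>X. card A + min (card X - lo) (hi + 1) \<le> card X \<and> (\<forall>C\<in>F. A \<subseteq> C \<longrightarrow> C = X)"
proof -
  define gen where "gen A \<longleftrightarrow> A \<subseteq> X \<and> (\<forall>C\<in>F. A \<subseteq> C \<longrightarrow> C = X)" for A
  define l where "l = min (card X - lo) (hi + 1)"
  have "gen X"
    using sub by (auto simp: gen_def)
  then obtain A where A: "gen A" and min: "\<And>A'. card A' < card A \<Longrightarrow> \<not> gen A'"
    using ex_has_least_nat[of gen X card] by (meson not_le)
  have AX: "A \<subseteq> X" "finite A"
    using A \<open>finite X\<close> finite_subset by (auto simp: gen_def)
  have "card A + l \<le> card X"
  proof (rule ccontr)
    assume "\<not> ?thesis"
    then have big: "card X < card A + l"
      by simp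
    have cAX: "card A \<le> card X"
      using AX \<open>finite X\<close> by (simp add: card_mono)
    \<comment> \<open>A generator larger than \<open>hi + 1\<close> is cut down to that size, so
      that removing one element leaves a set with at most \<open>hi\<close> elements.\<close>
    define a where "a = min (card A) (hi + 1)"
    obtain A' where A': "A' \<subseteq> A" "card A' = a"
      by (metis a_def min.cobounded1 obtain_subset_with_card_n)
    have finA': "finite A'"
      using A' AX finite_subset by blast
    \<comment> \<open>The term \<open>card X - lo\<close> of the minimum forces
      \<open>lo < card A\<close>. The other term, \<open>hi + 1\<close>, bounds the number of points
      of \<open>X - A - V\<close> further down.\<close>
    have a: "lo < a" "a \<le> hi + 1" "a \<le> card A"
      using big cAX assms(6,7) by (auto simp: a_def l_def)
    define c where "c x = \<Inter>{C \<in> F. A' - {x} \<subseteq> C}" for x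
    have cF: "c x \<in> F" for x
      unfolding c_def
    proof (rule inter)
      show "{C \<in> F. A' - {x} \<subseteq> C} \<noteq> {}"
        using \<open>X \<in> F\<close> A' AX by auto
    qed auto
    \<comment> \<open>If the closure \<open>c x\<close> contained a further \<open>y\<close> of
      \<open>A\<close>, every closed set above \<open>A - {y}\<close> would contain \<open>y\<close>
      as well, so \<open>A - {y}\<close> would be a smaller generator.\<close>
    have c_A: "c x \<inter> A = A' - {x}" if "x \<in> A'" for x
    proof
      show "A' - {x} \<subseteq> c x \<inter> A"
        using A' by (auto simp: c_def)
      show "c x \<inter> A \<subseteq> A' - {x}"
      proof (rule ccontr)
        assume "\<not> ?thesis"
        then obtain y where y: "y \<in> c x" "y \<in> A" "y \<notin> A' - {x}"
          by blast
        have "\<not> gen (A - {y})"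
          using y AX by (intro min) (meson card_Diff1_less)
        then obtain C where C: "C \<in> F" "A - {y} \<subseteq> C" "C \<noteq> X"
          using AX by (auto simp: gen_def)
        moreover have "A' - {x} \<subseteq> C"
          using y A' C by blast
        ultimately have "c x \<subseteq> C"
          unfolding c_def by blast
        then have "A \<subseteq> C"
          using y C by auto
        then show False
          using A C by (auto simp: gen_def)
      qed
    qed
    have finc: "finite (c x)" for x
      using cF sub \<open>finite X\<close> finite_subset by metis
    \<comment> \<open>Since \<open>c x\<close> has at least \<open>a - 1 \<ge> lo\<close> elements,
      the gap forces more than \<open>hi\<close> of them, and exactly \<open>a - 1\<close> lie in
      \<open>A\<close>.\<close>
    have c_gt: "hi + 1 - a < card (c x - A)" if "x \<in> A'" for x
    proof -
      have "card (c x) = card (c x \<inter> A) + card (c x - A)"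
        using finc by (metis card_Int_Diff)
      also have "card (c x \<inter> A) = a - 1"
        using c_A that A' by simp
      finally show ?thesis
        using gap[OF cF[of x]] a by auto
    qed
    have "A' \<noteq> {}"
      using a A' by auto
    then obtain x0 where "x0 \<in> A'"
      by blast
    then have "hi + 1 - a \<le> card (X - A)"
      using c_gt[of x0] sub[OF cF[of x0]] card_mono[of "X - A" "c x0 - A"] \<open>finite X\<close> by fastforce
    \<comment> \<open>Removing \<open>V\<close> from the traces makes the gap condition apply at the exact size needed;
      it costs at most \<open>card V\<close> in the cardinality of the final intersection.\<close>
    then obtain V where V: "V \<subseteq> X - A" "card V = hi + 1 - a"
      by (meson obtain_subset_with_card_n)
    have finV: "finite V"
      using V \<open>finite X\<close> finite_subset by blast
    define \<gamma> where "\<gamma> x = c x - A - V" for x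
    have "card (X - A - V) = card X - card A - (hi + 1 - a)"
      using V AX finV by (simp add: card_Diff_subset)
    also have "\<dots> < a"
      using big cAX a by (auto simp: a_def l_def)
    finally have "card (X - A - V) < card A'"
      using A' by simp
    moreover have "\<gamma> x \<noteq> {} \<and> \<gamma> x \<subseteq> X - A - V" if "x \<in> A'" for x
    proof -
      have "\<not> c x - A \<subseteq> V"
        using c_gt[OF that] V finV card_mono[of V "c x - A"] by auto
      then show ?thesis
        using sub[OF cF[of x]] by (auto simp: \<gamma>_def)
    qed
    ultimately obtain J where J: "J \<subseteq> A'" "J \<noteq> {}" "card J = Suc (card (\<Inter>x\<in>J. \<gamma> x))"
      using exists_family_card_eq_Suc_card_Inter[OF finA', of "X - A - V" \<gamma>] \<open>finite X\<close> by blast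
    define C where "C = (\<Inter>x\<in>J. c x)"
    have CF: "C \<in> F"
      unfolding C_def using J cF by (intro inter) auto
    have finC: "finite C"
      using sub[OF CF] \<open>finite X\<close> finite_subset by blast
    have "C \<inter> A = (\<Inter>x\<in>J. c x \<inter> A)"
      using J by (auto simp: C_def)
    also have "\<dots> = (\<Inter>x\<in>J. A' - {x})"
      using J c_A by (intro INF_cong) auto
    also have "\<dots> = A' - J"
      using J by auto
    finally have "card (C \<inter> A) = a - card J"
      using J A' finA' by (simp add: card_Diff_subset finite_subset)
    moreover have "(\<Inter>x\<in>J. \<gamma> x) = C - A - V"
      using J by (auto simp: C_def \<gamma>_def)
    moreover have "card C = card (C \<inter> A) + (card ((C - A) \<inter> V) + card (C - A - V))"
      using finC by (metis card_Int_Diff finite_Diff)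
    moreover have "card ((C - A) \<inter> V) \<le> hi + 1 - a"
      using V finV by (metis card_mono inf_le2)
    moreover have "card J \<le> a"
      using J A' finA' card_mono by metis
    \<comment> \<open>The \<open>a - card J\<close> elements in \<open>A\<close> and the
      \<open>card J - 1\<close> common points of the traces make \<open>a - 1 \<ge> lo\<close>; the
      part in \<open>V\<close> adds at most \<open>hi + 1 - a\<close>, which stops at
      \<open>hi\<close>.\<close>
    ultimately have "card C \<in> {lo..hi}"
      using J(3) a by auto
    then show False
      using gap[OF CF] by simp
  qed
  then show ?thesis
    using A by (auto simp: gen_def l_def)
qed

section \<open>Counting messages and the lower bound on the code length\<close>

lemma card_msgs: "finite (msgs m k)" "card (msgs m k) = 2 ^ (m * k)"
proof -
  have "bij_betw (\<lambda>W. {(i, j). W i j}) (msgs m k) (Pow ({..<m} \<times> {..<k}))"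
  proof (rule bij_betw_byWitness[where f' = "\<lambda>R i j. (i, j) \<in> R"])
    show "(\<lambda>W. {(i, j). W i j}) ` msgs m k \<subseteq> Pow ({..<m} \<times> {..<k})"
      unfolding msgs_def by (auto simp flip: not_le)
  qed (auto simp: msgs_def)
  then show "finite (msgs m k)" "card (msgs m k) = 2 ^ (m * k)"
    by (auto simp: bij_betw_finite bij_betw_same_card card_Pow)
qed

lemma finite_users: "finite (users m S)"
  by (rule finite_subset[of _ "Pow {..<m}"]) (auto simp: users_def)

lemma ex_message_not_in_user:
  assumes "hi < m" "A \<in> users m {lo..hi}"
  shows "\<exists>i. i < m \<and> i \<notin> A"
proof (rule ccontr)
  assume "\<not> ?thesis"
  then have "A = {..<m}"
    using assms by (auto simp: users_def)
  then show False
    using assms by (simp add: users_def)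
qed

text \<open>By the union bound, all users decode correctly at once on the set \<open>G\<close>,
  which misses at most a fraction \<open>card (users m {lo..hi}) * eps\<close> of the tuples. On
  \<open>G\<close> the transmitted bits and the messages in a small generator determine the
  tuple.\<close>

lemma valid_code_bound:
  assumes valid: "valid_code m {lo..hi} k L eps enc dec d" and "lo \<le> hi" "hi < m"
  shows "(1 - real (card (users m {lo..hi})) * eps) * 2 ^ (m * k)
    \<le> 2 ^ ((m - min (m - lo) (hi + 1)) * k + L)"
proof -
  define M where "M = msgs m k"
  define Us where "Us = users m {lo..hi}"
  define Err where "Err A = {W \<in> M. dec A (side_info A W) (trunc L (enc W)) \<noteq> W (d A)}" for A
  define G where "G = M - (\<Union>A\<in>Us. Err A)"
  have finM: "finite M" and cM: "card M = 2 ^ (m * k)"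
    by (simp_all add: M_def card_msgs)
  have finU: "finite Us"
    by (simp add: Us_def finite_users)
  have d: "d A < m" "d A \<notin> A" if "A \<in> Us" for A
    using valid that by (auto simp: valid_code_def Us_def)
  have cErr: "real (card (Err A)) \<le> eps * 2 ^ (m * k)" if "A \<in> Us" for A
  proof -
    have "real (card (Err A)) / real (card M) \<le> eps"
      using valid that by (auto simp: valid_code_def Us_def err_prob_def Err_def M_def)
    then show ?thesis
      by (simp add: cM field_simps)
  qed
  have "real (card (\<Union>A\<in>Us. Err A)) \<le> real (\<Sum>A\<in>Us. card (Err A))"
    using card_UN_le[OF finU] of_nat_mono by blast
  also have "\<dots> \<le> (\<Sum>A\<in>Us. eps * 2 ^ (m * k))"
    unfolding of_nat_sum using cErr by (rule sum_mono)
  finally have "real (card M) - real (card Us) * eps * 2 ^ (m * k) \<le> real (card M) - real (card (\<Union>A\<in>Us. Err A))"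
    by simp
  also have "\<dots> \<le> real (card G)"
    using diff_card_le_card_Diff[of "\<Union>A\<in>Us. Err A" M] finM finU
    by (simp add: G_def Err_def)
  finally have low: "(1 - real (card Us) * eps) * 2 ^ (m * k) \<le> real (card G)"
    by (simp add: cM algebra_simps)

  define F where "F = {C. C \<subseteq> {..<m} \<and> (\<forall>A\<in>Us. A \<subseteq> C \<longrightarrow> d A \<in> C)}"
  have "\<exists>A\<subseteq>{..<m}. card A + min (card {..<m} - lo) (hi + 1) \<le> card {..<m}
      \<and> (\<forall>C\<in>F. A \<subseteq> C \<longrightarrow> C = {..<m})"
  proof (rule closure_system_small_generator)
    show "\<Inter>H \<in> F" if "H \<subseteq> F" "H \<noteq> {}" for H
      using that unfolding F_def by blast
    \<comment> \<open>A closed set of such a cardinality would be the side information of some user,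
      and would have to contain the desired message of that user.\<close>
    show "card C \<notin> {lo..hi}" if "C \<in> F" for C
      using that d by (auto simp: F_def Us_def users_def)
  qed (use d \<open>lo \<le> hi\<close> \<open>hi < m\<close> in \<open>auto simp: F_def\<close>)
  then obtain A where A: "A \<subseteq> {..<m}" "card A + min (m - lo) (hi + 1) \<le> m"
    and gen: "\<And>C. C \<in> F \<Longrightarrow> A \<subseteq> C \<Longrightarrow> C = {..<m}"
    by auto
  have finA: "finite A"
    using A finite_subset by blast
  define f where "f W = ({(i, j). i \<in> A \<and> W i j}, {t. t < L \<and> enc W t})" for W :: "nat \<Rightarrow> nat \<Rightarrow> bool"
  have "inj_on f G"
  proof
    fix W W' assume W: "W \<in> G" "W' \<in> G" "f W = f W'"
    define C where "C = {i. i < m \<and> W i = W' i}"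
    have tr: "trunc L (enc W) = trunc L (enc W')"
      using W(3) by (auto simp: f_def trunc_def fun_eq_iff)
    have "C \<in> F"
    proof -
      have "d B \<in> C" if B: "B \<in> Us" "B \<subseteq> C" for B
      proof -
        have "side_info B W = side_info B W'"
          using B by (auto simp: side_info_def C_def fun_eq_iff)
        moreover have "W (d B) = dec B (side_info B W) (trunc L (enc W))"
          "W' (d B) = dec B (side_info B W') (trunc L (enc W'))"
          using W B by (auto simp: G_def Err_def)
        ultimately show ?thesis
          using tr d B by (simp add: C_def)
      qed
      then show ?thesis
        by (auto simp: F_def C_def)
    qed
    moreover have "A \<subseteq> C"
      using W(3) A by (auto simp: f_def C_def fun_eq_iff)
    ultimately have "C = {..<m}"
      by (rule gen)
    then have "W i = W' i" if "i < m" for i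
      using that by (auto simp: C_def)
    moreover have "W i = W' i" if "\<not> i < m" for i
      using that W by (auto simp: G_def M_def msgs_def fun_eq_iff)
    ultimately show "W = W'"
      by blast
  qed
  moreover have "f ` G \<subseteq> Pow (A \<times> {..<k}) \<times> Pow {..<L}"
    by (auto simp: f_def G_def M_def msgs_def simp flip: not_le)
  ultimately have "card G \<le> card (Pow (A \<times> {..<k}) \<times> Pow {..<L})"
    using finA by (intro card_inj_on_le) auto
  also have "\<dots> = 2 ^ (card A * k + L)"
    using finA by (simp add: card_cartesian_product card_Pow power_add)
  also have "\<dots> \<le> 2 ^ ((m - min (m - lo) (hi + 1)) * k + L)"
    using A by (intro power_increasing add_mono mult_right_mono) auto
  finally have "real (card G) \<le> 2 ^ ((m - min (m - lo) (hi + 1)) * k + L)"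
    by (metis of_nat_le_iff of_nat_numeral of_nat_power)
  then show ?thesis
    using low unfolding Us_def by linarith
qed

text \<open>With a rate \<open>x\<close> below the bound, at most a fraction
  \<open>2 powr ((x - l) * k)\<close> of the tuples can be decoded by all users. As
  \<open>k \<ge> 1\<close> this is at most \<open>q < 1\<close> for every \<open>k\<close>, so
  \<open>eps\<close> can be fixed before the code is known.\<close>

lemma achievable_ge:
  assumes ach: "achievable m {lo..hi} x" and "lo \<le> hi" "hi < m"
  shows "real (min (m - lo) (hi + 1)) \<le> x"
proof (rule ccontr)
  define l where "l = min (m - lo) (hi + 1)"
  define n where "n = card (users m {lo..hi})"
  define q where "q = 2 powr (x - real l)"
  assume "\<not> ?thesis"
  then have xl: "x < real l"
    by (simp add: l_def)
  have lm: "l \<le> m"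
    by (simp add: l_def)
  have q1: "q < 1"
    using xl powr_less_mono[of "x - real l" 0 2] by (simp add: q_def)
  \<comment> \<open>The denominator \<open>n + 1\<close> makes \<open>n * eps\<close> strictly
    smaller than \<open>1 - q\<close>.\<close>
  define eps where "eps = (1 - q) / (real n + 1)"
  have "0 < eps"
    using q1 by (simp add: eps_def)
  then obtain k L enc dec d where k: "0 < k" "real L \<le> x * real k"
    and valid: "valid_code m {lo..hi} k L eps enc dec d"
    using ach unfolding achievable_def by blast
  have "(1 - real n * eps) * 2 ^ (m * k) \<le> 2 ^ ((m - l) * k + L)"
    using valid_code_bound[OF valid \<open>lo \<le> hi\<close> \<open>hi < m\<close>] by (simp add: l_def n_def)
  also have "\<dots> = 2 powr (real (m - l) * real k + real L)"
    by (simp flip: powr_realpow)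
  also have "\<dots> \<le> 2 powr (real (m * k) + (x - real l) * real k)"
    using k lm by (intro powr_mono) (simp_all add: of_nat_diff algebra_simps)
  also have "\<dots> = 2 powr ((x - real l) * real k) * 2 ^ (m * k)"
    by (simp add: powr_add flip: powr_realpow)
  finally have "1 - real n * eps \<le> 2 powr ((x - real l) * real k)"
    by simp
  also have "\<dots> \<le> q"
    unfolding q_def using k xl mult_left_mono_neg[of 1 "real k" "x - real l"]
    by (intro powr_mono) auto
  finally have "1 - q \<le> real n * eps"
    by simp
  also have "\<dots> < (real n + 1) * eps"
    using \<open>0 < eps\<close> by simp
  also have "\<dots> = 1 - q"
    by (simp add: eps_def)
  finally show False
    by simp
qed

section \<open>Uncoded transmission\<close>

text \<open>One-bit messages suffice. A user knows at most \<open>hi\<close> messages, so at least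
  one of the first \<open>hi + 1\<close> is new to it and is read directly from the
  codeword.\<close>

lemma uncoded_valid:
  assumes "lo \<le> hi" "hi < m"
  shows "\<exists>k enc dec d. 0 < k \<and> linear_enc m k ((hi + 1) * k) enc
            \<and> valid_code m {lo..hi} k ((hi + 1) * k) 0 enc dec d"
proof -
  define enc where "enc W t = W t 0" for W :: "nat \<Rightarrow> nat \<Rightarrow> bool" and t :: nat
  define d where "d A = (SOME i. i < hi + 1 \<and> i \<notin> A)" for A :: "nat set"
  define dec where "dec A s x = (\<lambda>j. j = (0 :: nat) \<and> x (d A))"
    for A :: "nat set" and s :: "nat \<Rightarrow> nat \<Rightarrow> bool" and x :: "nat \<Rightarrow> bool"
  have "d A < hi + 1 \<and> d A \<notin> A" if "A \<in> users m {lo..hi}" for A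
    unfolding d_def
  proof (rule someI_ex, rule ccontr)
    assume "\<not> (\<exists>i. i < hi + 1 \<and> i \<notin> A)"
    then have "card {..<hi + 1} \<le> card A"
      using that finite_subset[of A "{..<m}"] by (intro card_mono) (auto simp: users_def)
    then show False
      using that by (simp add: users_def)
  qed
  moreover have "err_prob m 1 (hi + 1) enc (dec A) A (d A) = 0" if "d A < hi + 1" for A
  proof -
    have "W i j \<longleftrightarrow> j = 0 \<and> W i 0" if "W \<in> msgs m 1" for W i j
      using that by (cases j) (auto simp: msgs_def)
    then have "{W \<in> msgs m 1. dec A (side_info A W) (trunc (hi + 1) (enc W)) \<noteq> W (d A)} = {}"
      using that by (auto simp: dec_def trunc_def enc_def fun_eq_iff)
    then show ?thesis
      by (simp only: err_prob_def card.empty of_nat_0 div_0)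
  qed
  ultimately have "valid_code m {lo..hi} 1 ((hi + 1) * 1) 0 enc dec d"
    unfolding valid_code_def mult_1_right using \<open>hi < m\<close> by force
  moreover have "linear_enc m 1 ((hi + 1) * 1) enc"
    by (auto simp: linear_enc_def trunc_def enc_def)
  ultimately show ?thesis
    using zero_less_one by blast
qed

section \<open>Vandermonde codes over polynomials modulo \<open>f\<close>\<close>

text \<open>Combine the power sums with the coefficients of the polynomial \<open>q\<close> that
  vanishes at every \<open>\<alpha> j\<close> except \<open>\<alpha> i\<close>: only
  \<open>u i\<close> times a product of differences survives. The hypothesis \<open>cancel\<close>
  removes these factors one at a time, in place of inverting them. The degree of \<open>q\<close> is
  \<open>card T - 1 < g\<close>, so only the given power sums occur.\<close>

lemma dvd_of_vandermonde:
  fixes f :: "'a :: comm_ring_1" and \<alpha> u :: "'i \<Rightarrow> 'a"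
  assumes "finite T" "card T \<le> g" "i \<in> T"
    and cancel: "\<And>i j v. i \<in> T \<Longrightarrow> j \<in> T \<Longrightarrow> i \<noteq> j \<Longrightarrow> f dvd (\<alpha> i - \<alpha> j) * v \<Longrightarrow> f dvd v"
    and dvd: "\<And>s. s < g \<Longrightarrow> f dvd (\<Sum>j\<in>T. \<alpha> j ^ s * u j)"
  shows "f dvd u i"
proof -
  define q where "q = (\<Prod>j\<in>T - {i}. [:- \<alpha> j, 1:])"
  have "degree q \<le> (\<Sum>j\<in>T - {i}. degree [:- \<alpha> j, 1:])"
    unfolding q_def using degree_prod_sum_le[of "T - {i}" "\<lambda>j. [:- \<alpha> j, 1:]"] \<open>finite T\<close> by simp
  also have "\<dots> = card T - 1"
    using assms by simp
  finally have deg: "degree q < g"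
    using assms card_gt_0_iff[of T] by auto
  have "(\<Sum>j\<in>T. poly q (\<alpha> j) * u j) = (\<Sum>s\<le>degree q. coeff q s * (\<Sum>j\<in>T. \<alpha> j ^ s * u j))"
    unfolding poly_altdef sum_distrib_left sum_distrib_right
    by (subst sum.swap) (simp add: mult.assoc)
  also have "f dvd \<dots>"
  proof (rule dvd_sum)
    show "f dvd coeff q s * (\<Sum>j\<in>T. \<alpha> j ^ s * u j)" if "s \<in> {..degree q}" for s
      using that deg by (intro dvd_mult dvd) simp
  qed
  also have "(\<Sum>j\<in>T. poly q (\<alpha> j) * u j) = poly q (\<alpha> i) * u i + (\<Sum>j\<in>T - {i}. poly q (\<alpha> j) * u j)"
    using assms by (simp add: sum.remove)
  also have "(\<Sum>j\<in>T - {i}. poly q (\<alpha> j) * u j) = 0"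
  proof (rule sum.neutral, rule ballI)
    fix j assume "j \<in> T - {i}"
    then have "poly q (\<alpha> j) = 0"
      unfolding q_def poly_prod using \<open>finite T\<close> by (intro prod_zero) auto
    then show "poly q (\<alpha> j) * u j = 0"
      by simp
  qed
  finally have "f dvd (\<Prod>j\<in>T - {i}. \<alpha> i - \<alpha> j) * u i"
    by (simp add: q_def poly_prod)
  moreover have "f dvd v" if "R \<subseteq> T - {i}" "f dvd (\<Prod>j\<in>R. \<alpha> i - \<alpha> j) * v" for R v
  proof -
    have "finite R"
      using that \<open>finite T\<close> finite_subset by blast
    then show ?thesis
      using that
    proof (induction R)
      case (insert j R)
      then have "f dvd (\<alpha> i - \<alpha> j) * ((\<Prod>j\<in>R. \<alpha> i - \<alpha> j) * v)"
        by (simp add: mult.assoc)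
      then show ?case
        using insert cancel[of i j] \<open>i \<in> T\<close> by auto
    qed simp
  qed
  ultimately show ?thesis
    by blast
qed

text \<open>
  Euclid's trick provides a modulus coprime to all the differences \<open>X ^ i - X ^ j\<close>, so that
  no finite field is needed.
\<close>

lemma exists_modulus:
  obtains f :: "'a :: field poly" where "0 < degree f"
    "\<And>i j v. i < m \<Longrightarrow> j < m \<Longrightarrow> i \<noteq> j \<Longrightarrow> f dvd (monom 1 i - monom 1 j) * v \<Longrightarrow> f dvd v"
proof -
  define I where "I = {(i, j). i < m \<and> j < m \<and> i \<noteq> j}"
  have finI: "finite I"
    by (rule finite_subset[of _ "{..<m} \<times> {..<m}"]) (auto simp: I_def)
  define P :: "'a poly" where "P = (\<Prod>(i, j)\<in>I. monom 1 i - monom 1 j)"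
  have "P \<noteq> 0"
    unfolding P_def using finI by (auto simp: I_def monom_eq_iff')
  \<comment> \<open>The factor \<open>[:0, 1:]\<close> keeps the degree of the modulus positive even
    if \<open>P\<close> is the empty product.\<close>
  then have "degree ([:0, 1:] * P) = Suc (degree P)"
    by (subst degree_mult_eq) auto
  then have deg: "degree (1 + [:0, 1:] * P) = Suc (degree P)"
    by (subst degree_add_eq_right) auto
  have cancel: "1 + [:0, 1:] * P dvd v"
    if ij: "i < m" "j < m" "i \<noteq> j" and dvd: "1 + [:0, 1:] * P dvd (monom 1 i - monom 1 j) * v" for i j v
  proof -
    have "(\<lambda>(i, j). monom 1 i - monom 1 j) (i, j) dvd P"
      unfolding P_def using finI ij by (intro dvd_prodI) (auto simp: I_def)
    then obtain e where "P = (monom 1 i - monom 1 j) * e"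
      by (auto elim: dvdE)
    then have "P * v = e * ((monom 1 i - monom 1 j) * v)"
      by (simp only: mult_ac)
    then have "1 + [:0, 1:] * P dvd [:0, 1:] * (P * v)"
      using dvd by (metis dvd_mult)
    moreover have "v = (1 + [:0, 1:] * P) * v - [:0, 1:] * (P * v)"
      by (simp only: distrib_right mult_1_left mult.assoc add_diff_cancel_right')
    ultimately show ?thesis
      by (metis dvd_diff dvd_triv_left)
  qed
  show thesis
    by (rule that[of "1 + [:0, 1:] * P"]) (simp only: deg zero_less_Suc, rule cancel)
qed

definition bits_poly :: "nat \<Rightarrow> (nat \<Rightarrow> bool) \<Rightarrow> bit poly" where
  "bits_poly k b = (\<Sum>j<k. monom (of_bool (b j)) j)"

lemma coeff_bits_poly: "coeff (bits_poly k b) j = of_bool (j < k \<and> b j)"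
  by (simp add: bits_poly_def coeff_sum of_bool_def)

lemma bits_poly_xor: "bits_poly k (\<lambda>j. b j \<noteq> c j) = bits_poly k b + bits_poly k c"
  by (intro poly_eqI) (auto simp: coeff_bits_poly)

text \<open>A user lacks at most \<open>m - lo\<close> messages, and the \<open>m - lo\<close>
  syndromes with nodes \<open>monom 1 i\<close> determine these modulo \<open>f\<close>. Message
  polynomials have degree below \<open>k = degree f\<close>, so their residues are the messages
  themselves. Every user recovers everything, and any missing message may serve as the desired
  one.\<close>

lemma vandermonde_code_valid:
  assumes "lo \<le> hi" "hi < m"
  shows "\<exists>k enc dec d. 0 < k \<and> linear_enc m k ((m - lo) * k) enc
            \<and> valid_code m {lo..hi} k ((m - lo) * k) 0 enc dec d"
proof -
  obtain f :: "bit poly" where f: "0 < degree f"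
    "\<And>i j v. i < m \<Longrightarrow> j < m \<Longrightarrow> i \<noteq> j \<Longrightarrow> f dvd (monom 1 i - monom 1 j) * v \<Longrightarrow> f dvd v"
    by (rule exists_modulus[of m]) (rule that)
  define k where "k = degree f"
  define L where "L = (m - lo) * k"
  have k: "0 < k"
    using f by (simp add: k_def)
  define syn where "syn W s = (\<Sum>i<m. monom 1 i ^ s * bits_poly k (W i)) mod f" for W s
  \<comment> \<open>The codeword consists of blocks of \<open>k\<close> bits; block \<open>s\<close>
    lists the coefficients of \<open>syn W s\<close>.\<close>
  define enc where "enc W t \<longleftrightarrow> coeff (syn W (t div k)) (t mod k) = 1" for W t
  define d where "d A = (SOME i. i < m \<and> i \<notin> A)" for A :: "nat set"
  \<comment> \<open>The decoder picks any tuple consistent with what the user sees;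
    \<open>unique\<close> below shows that there is only one.\<close>
  define dec where "dec A s x = (SOME W. W \<in> msgs m k \<and> side_info A W = s \<and> trunc L (enc W) = x) (d A)"
    for A s x
  have d: "d A < m \<and> d A \<notin> A" if "A \<in> users m {lo..hi}" for A
    unfolding d_def using ex_message_not_in_user[OF \<open>hi < m\<close> that] by (rule someI_ex)
  have syn_xor: "syn (\<lambda>i j. W i j \<noteq> W' i j) s = syn W s + syn W' s" for W W' s
    by (simp only: syn_def bits_poly_xor distrib_left sum.distrib poly_mod_add_left)
  have enc_xor: "enc (\<lambda>i j. W i j \<noteq> W' i j) t \<longleftrightarrow> enc W t \<noteq> enc W' t" for W W' t
    unfolding enc_def syn_xor coeff_add
    by (cases "coeff (syn W (t div k)) (t mod k)"; cases "coeff (syn W' (t div k)) (t mod k)") simp_all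
  have linear: "linear_enc m k L enc"
    by (simp only: linear_enc_def trunc_def enc_xor) auto

  have unique: "W = W'"
    if A: "A \<in> users m {lo..hi}" and W: "W \<in> msgs m k" "W' \<in> msgs m k"
      and si: "side_info A W = side_info A W'" and tr: "trunc L (enc W) = trunc L (enc W')"
    for A W W'
  proof -
    define u where "u i = bits_poly k (W i) - bits_poly k (W' i)" for i
    define T where "T = {..<m} - A"
    have Am: "A \<subseteq> {..<m}"
      using A by (auto simp: users_def)
    then have "card T = m - card A"
      by (simp add: T_def card_Diff_subset finite_subset[OF Am])
    then have cT: "card T \<le> m - lo"
      using A by (auto simp: users_def)
    have uA: "u i = 0" if "i \<in> A" for i
    proof -
      have "W i j = W' i j" for j
        using si that by (auto simp: side_info_def fun_eq_iff)
      then show ?thesis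
        by (simp add: u_def bits_poly_def)
    qed
    have syn_eq: "syn W s = syn W' s" if "s < m - lo" for s
    proof (rule poly_eqI)
      fix j
      show "coeff (syn W s) j = coeff (syn W' s) j"
      proof (cases "j < k")
        case True
        have "s * k + j < (s + 1) * k"
          using True by simp
        also have "\<dots> \<le> L"
          unfolding L_def using that by (intro mult_right_mono) auto
        finally have "enc W (s * k + j) = enc W' (s * k + j)"
          using tr by (auto simp: trunc_def fun_eq_iff)
        then show ?thesis
          using True by (auto simp: enc_def)
      next
        case False
        \<comment> \<open>Residues modulo \<open>f\<close> have no coefficients from position
          \<open>k\<close> on, so the transmitted blocks are the whole syndromes.\<close>
        have "syn V s = 0 \<or> degree (syn V s) < k" for V
          unfolding syn_def k_def using f(1) by (intro degree_mod_less) auto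
        then have "coeff (syn V s) j = 0" for V
          using False by (metis coeff_0 coeff_eq_0 le_less_trans not_le order.strict_trans2)
        then show ?thesis
          by simp
      qed
    qed
    have dvd: "f dvd u i" if "i \<in> T" for i
    proof (rule dvd_of_vandermonde[of T "m - lo" i f "\<lambda>i. monom 1 i" u])
      show "f dvd (\<Sum>j\<in>T. monom 1 j ^ s * u j)" if "s < m - lo" for s
      proof -
        have "f dvd (\<Sum>j<m. monom 1 j ^ s * bits_poly k (W j)) - (\<Sum>j<m. monom 1 j ^ s * bits_poly k (W' j))"
          using syn_eq[OF that] by (simp add: syn_def mod_eq_dvd_iff)
        also have "\<dots> = (\<Sum>j<m. monom 1 j ^ s * u j)"
          by (simp add: u_def sum_subtractf right_diff_distrib)
        also have "\<dots> = (\<Sum>j\<in>T. monom 1 j ^ s * u j)"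
          using uA by (intro sum.mono_neutral_right) (auto simp: T_def)
        finally show ?thesis .
      qed
    qed (use cT that f in \<open>auto simp: T_def\<close>)
    have u0: "u i = 0" if "i < m" for i
    proof (rule ccontr)
      assume "u i \<noteq> 0"
      then have "k \<le> degree (u i)"
        using dvd[of i] uA[of i] that by (auto simp: T_def k_def intro: dvd_imp_degree_le)
      moreover have "degree (u i) \<le> k - 1"
        using k by (intro degree_le) (auto simp: u_def coeff_bits_poly)
      ultimately show False
        using k by linarith
    qed
    show ?thesis
    proof (intro ext)
      fix i j
      show "W i j = W' i j"
      proof (cases "i < m \<and> j < k")
        case True
        then have "coeff (bits_poly k (W i)) j = coeff (bits_poly k (W' i)) j"
          using u0[of i] by (simp add: u_def)
        then show ?thesis
          using True by (simp add: coeff_bits_poly of_bool_eq_iff)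
      next
        case False
        then show ?thesis
          using W by (auto simp: msgs_def)
      qed
    qed
  qed

  have correct: "dec A (side_info A W) (trunc L (enc W)) = W (d A)"
    if "A \<in> users m {lo..hi}" "W \<in> msgs m k" for A W
  proof -
    have "(SOME V. V \<in> msgs m k \<and> side_info A V = side_info A W \<and> trunc L (enc V) = trunc L (enc W)) = W"
      using that unique by (intro some_equality) auto
    then show ?thesis
      by (simp add: dec_def)
  qed
  have "err_prob m k L enc (dec A) A (d A) = 0" if "A \<in> users m {lo..hi}" for A
  proof -
    have "{W \<in> msgs m k. dec A (side_info A W) (trunc L (enc W)) \<noteq> W (d A)} = {}"
      using correct that by blast
    then show ?thesis
      by (simp only: err_prob_def card.empty of_nat_0 div_0)
  qed
  then have "valid_code m {lo..hi} k L 0 enc dec d"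
    using d by (simp add: valid_code_def)
  then show ?thesis
    using k linear unfolding L_def by blast
qed

theorem theorem1:
  fixes m smin smax :: nat
  assumes "1 \<le> m" and "smin \<le> smax" and "smax \<le> m - 1"
  shows "opt_len m {smin..smax} = real (min (m - smin) (smax + 1))
       \<and> (\<exists>k enc dec d. 0 < k \<and> linear_enc m k (min (m - smin) (smax + 1) * k) enc
            \<and> valid_code m {smin..smax} k (min (m - smin) (smax + 1) * k) 0 enc dec d)"
proof -
  define l where "l = min (m - smin) (smax + 1)"
  have "smax < m"
    using assms by simp
  have "\<exists>k enc dec d. 0 < k \<and> linear_enc m k (l * k) enc
      \<and> valid_code m {smin..smax} k (l * k) 0 enc dec d"
  proof (cases "m - smin \<le> smax + 1")
    case True
    then have "l = m - smin"
      by (simp add: l_def)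
    then show ?thesis
      using vandermonde_code_valid[OF assms(2) \<open>smax < m\<close>] by (simp only:)
  next
    case False
    then have "l = smax + 1"
      by (simp add: l_def)
    then show ?thesis
      using uncoded_valid[OF assms(2) \<open>smax < m\<close>] by (simp only:)
  qed
  then obtain k enc dec d where code: "0 < k" "linear_enc m k (l * k) enc"
    "valid_code m {smin..smax} k (l * k) 0 enc dec d"
    by blast
  \<comment> \<open>One zero-error code serves every \<open>eps\<close>, so the infimum is attained
    at \<open>l\<close>.\<close>
  have "valid_code m {smin..smax} k (l * k) eps enc dec d" if "0 < eps" for eps
    using code(3) that unfolding valid_code_def by (meson less_imp_le order_trans)
  then have "achievable m {smin..smax} (real l)"
    using code(1) unfolding achievable_def by (metis of_nat_mult order_refl)
  moreover have "real l \<le> x" if "achievable m {smin..smax} x" for x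
    using achievable_ge[OF that assms(2) \<open>smax < m\<close>] by (simp add: l_def)
  ultimately have "opt_len m {smin..smax} = real l"
    unfolding opt_len_def by (intro cInf_eq_minimum) auto
  then show ?thesis
    using code unfolding l_def by blast
qed

end
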